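(* Let $W$ be a finite complex reflection group and $w\in W$. Then $[\mathrm{id},u]_{\ell_R}=[\mathrm{id},u]_{\mathrm{cdf}}$ for every $u<_{\mathrm{cdf}}w$ if and only if $\ell_R(u)=\operatorname{codim}\operatorname{fix}(u)$ for every $u<_{\mathrm{cdf}}w$.
   Context: A finite complex reflection group is a finite subgroup $W\subseteq GL(V)$, $V$ a finite-dimensional complex vector space, generated by its reflections, i.e. elements $g$ whose fixed space $\operatorname{fix}(g)=\ker(g-1)$ has codimension $1$. $R$ is the set of reflections of $W$, $\ell_R(g)$ is the minimal number of reflections with product $g$, and $\operatorname{codim}\operatorname{fix}(g)=\dim V-\dim\operatorname{fix}(g)$. For $f\in\{\ell_R,\operatorname{codim}\operatorname{fix}\}$, $x\le_f y$ iff $f(x)+f(x^{-1}y)=f(y)$, $x<_f y$ means $x\le_f y$ and $x\ne y$, and $[\mathrm{id},w]_f=\{u:u\le_f w\}$; subscript $\mathrm{cdf}$ refers to $f=\operatorname{codim}\operatorname{fix}$. *)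

theory Defs
  imports "HOL-Analysis.Analysis"
begin

text \<open>Linear maps of V = complex^n are represented by n x n complex matrices
  (the dimension n = CARD('n) is a type parameter).\<close>

type_synonym 'n cmat = "complex^'n^'n"

definition fixsp :: "'n::finite cmat \<Rightarrow> (complex^'n) set" where
  "fixsp g = {x. g *v x = x}"

text \<open>codimension of the fixed space, dimension taken over the complex numbers\<close>
definition codimfix :: "'n::finite cmat \<Rightarrow> nat" where
  "codimfix g = CARD('n) - vec.dim (fixsp g)"

definition is_reflection :: "'n::finite cmat \<Rightarrow> bool" where
  "is_reflection g \<longleftrightarrow> codimfix g = 1"

definition reflections :: "'n::finite cmat set \<Rightarrow> 'n cmat set" where
  "reflections W = {g \<in> W. is_reflection g}"

definition prod_mats :: "'n::finite cmat list \<Rightarrow> 'n cmat" where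
  "prod_mats rs = foldr (**) rs (mat 1)"

definition finite_complex_reflection_group :: "'n::finite cmat set \<Rightarrow> bool" where
  "finite_complex_reflection_group W \<longleftrightarrow>
     finite W \<and> mat 1 \<in> W \<and> (\<forall>g\<in>W. invertible g) \<and>
     (\<forall>g\<in>W. \<forall>h\<in>W. g ** h \<in> W) \<and> (\<forall>g\<in>W. matrix_inv g \<in> W) \<and>
     (\<forall>g\<in>W. \<exists>rs. set rs \<subseteq> reflections W \<and> prod_mats rs = g)"

text \<open>reflection length ell_R\<close>
definition reflength :: "'n::finite cmat set \<Rightarrow> 'n cmat \<Rightarrow> nat" where
  "reflength W g = (LEAST k. \<exists>rs. length rs = k \<and> set rs \<subseteq> reflections W \<and> prod_mats rs = g)"

text \<open>x \<le>_f y iff f x + f (x^-1 y) = f y\<close>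
definition le_f :: "('n::finite cmat \<Rightarrow> nat) \<Rightarrow> 'n cmat \<Rightarrow> 'n cmat \<Rightarrow> bool" where
  "le_f f x y \<longleftrightarrow> f x + f (matrix_inv x ** y) = f y"

definition lt_f :: "('n::finite cmat \<Rightarrow> nat) \<Rightarrow> 'n cmat \<Rightarrow> 'n cmat \<Rightarrow> bool" where
  "lt_f f x y \<longleftrightarrow> le_f f x y \<and> x \<noteq> y"

text \<open>[id, w]_f as a subset of W\<close>
definition interval_f :: "'n::finite cmat set \<Rightarrow> ('n cmat \<Rightarrow> nat) \<Rightarrow> 'n cmat \<Rightarrow> 'n cmat set" where
  "interval_f W f w = {u \<in> W. le_f f u w}"

end

theory Submission
  imports Defs
begin

text \<open>Write \<open>cdf\<close> for codim fix. It is subadditive and bounded by reflection length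
  \<open>\<ell>\<close>, and for \<open>v \<le>\<^sub>c\<^sub>d\<^sub>f u\<close> also \<open>v\<^sup>-\<^sup>1u \<le>\<^sub>c\<^sub>d\<^sub>f u\<close>. So if \<open>\<ell> = cdf\<close> on \<open>[id,u]\<^sub>c\<^sub>d\<^sub>f\<close>,
  then \<open>\<ell>(v) + \<ell>(v\<^sup>-\<^sup>1u) = \<ell>(u)\<close> and \<open>cdf(v) + cdf(v\<^sup>-\<^sup>1u) = cdf(u)\<close> are equivalent for all \<open>v\<close>.
  Conversely, induct on \<open>\<ell>(u)\<close>: write \<open>u = r u'\<close> with \<open>r\<close> the first reflection of a reduced
  word; then \<open>r \<le>\<^sub>\<ell> u\<close>, hence \<open>r \<le>\<^sub>c\<^sub>d\<^sub>f u\<close> by the interval equality, so \<open>u' \<le>\<^sub>c\<^sub>d\<^sub>f u\<close> and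
  \<open>cdf(u) = 1 + cdf(u') = 1 + \<ell>(u') = \<ell>(u)\<close>. Both directions only need the set of
  \<open>u <\<^sub>c\<^sub>d\<^sub>f w\<close> to be closed downwards under \<open>\<le>\<^sub>c\<^sub>d\<^sub>f\<close>.\<close>

lemma matrix_inv_right_left:
  fixes A :: "'a::semiring_1^'n^'n"
  assumes "invertible A"
  shows matrix_inv_right: "A ** matrix_inv A = mat 1"
    and matrix_inv_left: "matrix_inv A ** A = mat 1"
proof -
  have "\<exists>A'. A ** A' = mat 1 \<and> A' ** A = mat 1"
    using assms unfolding invertible_def by blast
  then have "A ** matrix_inv A = mat 1 \<and> matrix_inv A ** A = mat 1"
    unfolding matrix_inv_def by (rule someI_ex)
  then show "A ** matrix_inv A = mat 1" "matrix_inv A ** A = mat 1" by auto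
qed

lemma matrix_inv_cancel:
  fixes A B :: "'a::semiring_1^'n^'n"
  assumes "invertible A"
  shows matrix_inv_cancel_left: "A ** (matrix_inv A ** B) = B"
    and matrix_inv_cancel_left': "matrix_inv A ** (A ** B) = B"
  by (simp_all add: matrix_mul_assoc matrix_inv_right_left[OF assms])

lemma matrix_inv_unique:
  fixes A B :: "'a::field^'n^'n"
  assumes "B ** A = mat 1"
  shows "matrix_inv A = B"
proof -
  have "invertible A" using assms invertible_left_inverse by blast
  then have "B = B ** (A ** matrix_inv A)" by (simp add: matrix_inv_right)
  also have "\<dots> = matrix_inv A" by (simp add: matrix_mul_assoc assms)
  finally show ?thesis by simp
qed

lemma subspace_fixsp: "vec.subspace (fixsp g)"
  unfolding vec.subspace_def fixsp_def by (auto simp: vec.add vec.scale vec.zero)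

lemma dim_fixsp_le: "vec.dim (fixsp (g::'n::finite cmat)) \<le> CARD('n)"
  by (rule dim_subset_UNIV_cart_gen)

lemma codimfix_eq_0_iff:
  fixes g :: "'n::finite cmat"
  shows "codimfix g = 0 \<longleftrightarrow> g = mat 1"
proof
  assume "codimfix g = 0"
  then have "vec.dim (fixsp g) = vec.dim (UNIV :: (complex^'n) set)"
    using dim_fixsp_le[of g] unfolding codimfix_def vec_dim_card by simp
  then have "vec.span (fixsp g) = vec.span UNIV" by (intro vec.dim_eq_span) auto
  then have "fixsp g = UNIV" using vec.span_eq_iff subspace_fixsp by (metis vec.span_UNIV)
  then have "\<forall>x. g *v x = mat 1 *v x" unfolding fixsp_def by auto
  then show "g = mat 1" using matrix_eq by blast
next
  assume "g = mat 1"
  then have "fixsp g = UNIV" unfolding fixsp_def by simp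
  then show "codimfix g = 0" unfolding codimfix_def by (simp only: vec_dim_card diff_self_eq_0)
qed

lemma codimfix_mat_1 [simp]: "codimfix (mat 1 :: 'n::finite cmat) = 0"
  by (simp add: codimfix_eq_0_iff)

lemma codimfix_mult_le:
  fixes g h :: "'n::finite cmat"
  shows "codimfix (g ** h) \<le> codimfix g + codimfix h"
proof -
  let ?F = "fixsp g" and ?G = "fixsp h"
  have "?F \<inter> ?G \<subseteq> fixsp (g ** h)"
    unfolding fixsp_def by (auto simp flip: matrix_vector_mul_assoc)
  then have "vec.dim (?F \<inter> ?G) \<le> vec.dim (fixsp (g ** h))" by (rule vec.dim_subset)
  moreover have "vec.dim {x + y |x y. x \<in> ?F \<and> y \<in> ?G} + vec.dim (?F \<inter> ?G)
      = vec.dim ?F + vec.dim ?G"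
    using vec.dim_sums_Int[OF subspace_fixsp subspace_fixsp] .
  moreover have "vec.dim {x + y |x y. x \<in> ?F \<and> y \<in> ?G} \<le> CARD('n)"
    by (rule dim_subset_UNIV_cart_gen)
  ultimately show ?thesis
    unfolding codimfix_def using dim_fixsp_le[of g] dim_fixsp_le[of h] by linarith
qed

lemma codimfix_conjugate:
  fixes u v :: "'n::finite cmat"
  assumes "invertible u"
  shows "codimfix (matrix_inv u ** v ** u) = codimfix v"
proof -
  have "invertible (matrix_inv u)"
    unfolding invertible_def using matrix_inv_right_left[OF assms] by blast
  then have inj_u: "inj ((*v) u)" and inj_u': "inj ((*v) (matrix_inv u))"
    using assms inj_matrix_vector_mult by blast+
  have "x \<in> fixsp (matrix_inv u ** v ** u) \<longleftrightarrow> x \<in> (*v) u -` fixsp v" for x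
  proof -
    have "x = matrix_inv u *v (u *v x)"
      by (simp add: matrix_vector_mul_assoc matrix_inv_left[OF assms])
    then have "(matrix_inv u ** v ** u) *v x = x
        \<longleftrightarrow> matrix_inv u *v (v *v (u *v x)) = matrix_inv u *v (u *v x)"
      by (simp add: matrix_vector_mul_assoc matrix_mul_assoc)
    then show ?thesis unfolding fixsp_def using inj_u' by (simp add: inj_eq)
  qed
  then have "fixsp (matrix_inv u ** v ** u) = (*v) u -` fixsp v" by blast
  moreover have "surj ((*v) u)"
    by (metis assms matrix_inv_right matrix_vector_mul_assoc matrix_vector_mul_lid surjI)
  ultimately have "(*v) u ` fixsp (matrix_inv u ** v ** u) = fixsp v"
    by (simp add: surj_image_vimage_eq)
  moreover have "vec.dim ((*v) u ` fixsp (matrix_inv u ** v ** u))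
      = vec.dim (fixsp (matrix_inv u ** v ** u))"
    using inj_u by (intro vec.dim_image_eq matrix_vector_mul_linear_gen) (simp add: inj_on_def inj_def)
  ultimately show ?thesis unfolding codimfix_def by simp
qed

lemma le_codimfix_refl:
  fixes u :: "'n::finite cmat"
  assumes "invertible u"
  shows "le_f codimfix u u"
  unfolding le_f_def by (simp add: matrix_inv_left[OF assms])

lemma le_codimfix_trans:
  fixes x y z :: "'n::finite cmat"
  assumes "invertible x" "invertible y" "le_f codimfix x y" "le_f codimfix y z"
  shows "le_f codimfix x z"
proof -
  have "codimfix z \<le> codimfix x + codimfix (matrix_inv x ** z)"
    using codimfix_mult_le[of x "matrix_inv x ** z"] by (simp add: matrix_inv_cancel_left[OF assms(1)])
  moreover have "matrix_inv x ** z = (matrix_inv x ** y) ** (matrix_inv y ** z)"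
    by (simp add: matrix_inv_cancel_left[OF assms(2)] flip: matrix_mul_assoc)
  then have "codimfix (matrix_inv x ** z)
      \<le> codimfix (matrix_inv x ** y) + codimfix (matrix_inv y ** z)"
    using codimfix_mult_le by metis
  ultimately show ?thesis using assms(3,4) unfolding le_f_def by linarith
qed

lemma le_codimfix_antisym:
  fixes x y :: "'n::finite cmat"
  assumes "invertible x" "le_f codimfix x y" "le_f codimfix y x"
  shows "x = y"
proof -
  have "codimfix (matrix_inv x ** y) = 0" using assms(2,3) unfolding le_f_def by linarith
  then have "x ** (matrix_inv x ** y) = x" by (simp add: codimfix_eq_0_iff)
  then show ?thesis by (simp add: matrix_inv_cancel_left[OF assms(1)])
qed

lemma le_lt_codimfix_trans:
  fixes x y z :: "'n::finite cmat"
  assumes "invertible x" "invertible y" "le_f codimfix x y" "lt_f codimfix y z"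
  shows "lt_f codimfix x z"
  using assms le_codimfix_trans le_codimfix_antisym unfolding lt_f_def by metis

text \<open>The complement \<open>v\<^sup>-\<^sup>1u\<close> of \<open>v\<close> in \<open>u\<close> is again below \<open>u\<close>: its own complement
  \<open>u\<^sup>-\<^sup>1vu\<close> is conjugate to \<open>v\<close>.\<close>

lemma le_codimfix_complement:
  fixes u v :: "'n::finite cmat"
  assumes "invertible u" "invertible v" "le_f codimfix v u"
  shows "le_f codimfix (matrix_inv v ** u) u"
proof -
  have "(matrix_inv u ** v) ** (matrix_inv v ** u) = mat 1"
    by (simp add: matrix_inv_cancel_left[OF assms(2)] matrix_inv_left[OF assms(1)]
        flip: matrix_mul_assoc)
  then have "matrix_inv (matrix_inv v ** u) ** u = matrix_inv u ** v ** u"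
    by (simp add: matrix_inv_unique)
  then show ?thesis
    using assms(3) codimfix_conjugate[OF assms(1), of v] unfolding le_f_def by simp
qed

lemma prod_mats_Nil [simp]: "prod_mats [] = mat 1"
  and prod_mats_Cons [simp]: "prod_mats (r # rs) = r ** prod_mats rs"
  by (simp_all add: prod_mats_def)

context
  fixes W :: "'n::finite cmat set"
  assumes W: "finite_complex_reflection_group W"
begin

lemma reflection_group_invertible: "g \<in> W \<Longrightarrow> invertible g"
  and reflection_group_mult_closed: "g \<in> W \<Longrightarrow> h \<in> W \<Longrightarrow> g ** h \<in> W"
  and reflection_group_inv_closed: "g \<in> W \<Longrightarrow> matrix_inv g \<in> W"
  using W unfolding finite_complex_reflection_group_def by blast+

lemma prod_mats_in_reflection_group: "set rs \<subseteq> reflections W \<Longrightarrow> prod_mats rs \<in> W"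
  using W reflection_group_mult_closed
  by (induction rs) (auto simp: finite_complex_reflection_group_def reflections_def)

lemma reflength_obtain:
  assumes "g \<in> W"
  obtains rs where "length rs = reflength W g" "set rs \<subseteq> reflections W" "prod_mats rs = g"
proof -
  obtain rs where "set rs \<subseteq> reflections W \<and> prod_mats rs = g"
    using W assms unfolding finite_complex_reflection_group_def by blast
  then have "\<exists>k rs. length rs = k \<and> set rs \<subseteq> reflections W \<and> prod_mats rs = g" by blast
  then have "\<exists>rs. length rs = reflength W g \<and> set rs \<subseteq> reflections W \<and> prod_mats rs = g"
    unfolding reflength_def by (rule LeastI_ex)
  then show ?thesis using that by blast
qed

lemma reflength_prod_mats_le: "set rs \<subseteq> reflections W \<Longrightarrow> reflength W (prod_mats rs) \<le> length rs"
  unfolding reflength_def by (rule Least_le) blast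

lemma codimfix_prod_mats_le: "set rs \<subseteq> reflections W \<Longrightarrow> codimfix (prod_mats rs) \<le> length rs"
proof (induction rs)
  case (Cons r rs)
  then have "codimfix r = 1" by (simp add: reflections_def is_reflection_def)
  with Cons show ?case using codimfix_mult_le[of r "prod_mats rs"] by simp
qed simp

lemma codimfix_le_reflength: "g \<in> W \<Longrightarrow> codimfix g \<le> reflength W g"
  by (metis reflength_obtain codimfix_prod_mats_le)

lemma reflength_reflection:
  assumes "r \<in> reflections W"
  shows "reflength W r = 1"
proof -
  have "reflength W (prod_mats [r]) \<le> 1" using reflength_prod_mats_le[of "[r]"] assms by simp
  moreover have "codimfix r \<le> reflength W r"
    using assms codimfix_le_reflength by (simp add: reflections_def)
  ultimately show ?thesis using assms by (simp add: reflections_def is_reflection_def)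
qed

lemma reflength_Suc_obtain:
  assumes "u \<in> W" "reflength W u = Suc n"
  obtains r u' where "r \<in> reflections W" "u' \<in> W" "u = r ** u'" "reflength W u' = n"
proof -
  obtain rs where rs: "length rs = Suc n" "set rs \<subseteq> reflections W" "prod_mats rs = u"
    using reflength_obtain[OF assms(1)] assms(2) by auto
  then obtain r rs' where r: "rs = r # rs'" by (cases rs) auto
  have "reflength W u' = n" if "u' = prod_mats rs'" for u'
  proof -
    have "u' \<in> W" using prod_mats_in_reflection_group rs(2) r that by simp
    then obtain rs'' where rs'': "length rs'' = reflength W u'" "set rs'' \<subseteq> reflections W"
        "prod_mats rs'' = u'"
      by (rule reflength_obtain)
    have "Suc n \<le> length (r # rs'')"
      using reflength_prod_mats_le[of "r # rs''"] rs rs'' r that assms(2) by simp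
    moreover have "reflength W u' \<le> n"
      using reflength_prod_mats_le[of rs'] rs r that by simp
    ultimately show ?thesis using rs'' by simp
  qed
  then show ?thesis using that[of r "prod_mats rs'"] rs r prod_mats_in_reflection_group[of rs'] by auto
qed

lemma interval_reflength_eq_interval_codimfix:
  assumes "u \<in> W" and eq: "\<forall>v \<in> interval_f W codimfix u. reflength W v = codimfix v"
  shows "interval_f W (reflength W) u = interval_f W codimfix u"
proof -
  have iu: "invertible u" using assms(1) reflection_group_invertible by blast
  have lu: "reflength W u = codimfix u"
    using eq assms(1) le_codimfix_refl[OF iu] unfolding interval_f_def by blast
  have "le_f (reflength W) v u \<longleftrightarrow> le_f codimfix v u" if vW: "v \<in> W" for v
  proof -
    define v' where "v' = matrix_inv v ** u"
    have iv: "invertible v" using vW reflection_group_invertible by blast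
    have v'W: "v' \<in> W" unfolding v'_def using vW assms(1) reflection_group_mult_closed reflection_group_inv_closed by blast
    have "codimfix u \<le> codimfix v + codimfix v'"
      using codimfix_mult_le[of v v'] unfolding v'_def by (simp add: matrix_inv_cancel_left[OF iv])
    moreover have "codimfix v \<le> reflength W v" "codimfix v' \<le> reflength W v'"
      using vW v'W codimfix_le_reflength by blast+
    moreover have "reflength W v = codimfix v \<and> reflength W v' = codimfix v'"
      if "le_f codimfix v u"
      using eq vW v'W that le_codimfix_complement[OF iu iv that]
      unfolding interval_f_def v'_def by blast
    ultimately show ?thesis using lu unfolding le_f_def v'_def[symmetric] by fastforce
  qed
  then show ?thesis unfolding interval_f_def by blast
qed

lemma codimfix_reduced_prefix:
  assumes "u \<in> W" "interval_f W (reflength W) u = interval_f W codimfix u"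
    and "r \<in> reflections W" "u' \<in> W" "u = r ** u'" "reflength W u = Suc (reflength W u')"
  shows "le_f codimfix u' u" and "codimfix u = Suc (codimfix u')"
proof -
  have rW: "r \<in> W" and ir: "invertible r" and cr: "codimfix r = 1"
    using assms(3) reflection_group_invertible by (auto simp: reflections_def is_reflection_def)
  have u': "matrix_inv r ** u = u'"
    unfolding assms(5) by (simp add: matrix_inv_cancel_left'[OF ir])
  have "le_f (reflength W) r u"
    unfolding le_f_def using u' assms(6) reflength_reflection[OF assms(3)] by simp
  then have "le_f codimfix r u" using assms(2) rW unfolding interval_f_def by blast
  then show "le_f codimfix u' u" "codimfix u = Suc (codimfix u')"
    using le_codimfix_complement[OF reflection_group_invertible[OF assms(1)] ir] u' cr
    unfolding le_f_def by simp_all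
qed

lemma intervals_eq_iff_reflength_eq_codimfix:
  assumes "S \<subseteq> W"
    and down_closed: "\<And>u v. u \<in> S \<Longrightarrow> v \<in> W \<Longrightarrow> le_f codimfix v u \<Longrightarrow> v \<in> S"
  shows "(\<forall>u\<in>S. interval_f W (reflength W) u = interval_f W codimfix u)
     \<longleftrightarrow> (\<forall>u\<in>S. reflength W u = codimfix u)"
proof
  assume eq: "\<forall>u\<in>S. interval_f W (reflength W) u = interval_f W codimfix u"
  have "reflength W u = codimfix u" if "u \<in> S" "reflength W u = n" for u n
    using that
  proof (induction n arbitrary: u)
    case 0
    then show ?case using assms(1) codimfix_le_reflength by fastforce
  next
    case (Suc n)
    obtain r u' where ru': "r \<in> reflections W" "u' \<in> W" "u = r ** u'" "reflength W u' = n"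
      using reflength_Suc_obtain Suc.prems assms(1) by blast
    have "le_f codimfix u' u" "codimfix u = Suc (codimfix u')"
      using codimfix_reduced_prefix[OF _ _ ru'(1-3)] Suc.prems ru'(4) eq assms(1) by auto
    then show ?case using Suc down_closed ru' by simp
  qed
  then show "\<forall>u\<in>S. reflength W u = codimfix u" by blast
next
  assume "\<forall>u\<in>S. reflength W u = codimfix u"
  then show "\<forall>u\<in>S. interval_f W (reflength W) u = interval_f W codimfix u"
    using assms interval_reflength_eq_interval_codimfix unfolding interval_f_def by blast
qed

end

theorem mainTheorem13:
  fixes W :: "'n::finite cmat set" and w :: "'n cmat"
  assumes "finite_complex_reflection_group W" and "w \<in> W"
  shows "(\<forall>u\<in>W. lt_f codimfix u w \<longrightarrow>
            interval_f W (reflength W) u = interval_f W codimfix u)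
     \<longleftrightarrow> (\<forall>u\<in>W. lt_f codimfix u w \<longrightarrow> reflength W u = codimfix u)"
proof -
  let ?S = "{u \<in> W. lt_f codimfix u w}"
  have "v \<in> ?S" if "u \<in> ?S" "v \<in> W" "le_f codimfix v u" for u v
    using that le_lt_codimfix_trans reflection_group_invertible[OF assms(1)] by blast
  then have "(\<forall>u\<in>?S. interval_f W (reflength W) u = interval_f W codimfix u)
      \<longleftrightarrow> (\<forall>u\<in>?S. reflength W u = codimfix u)"
    by (intro intervals_eq_iff_reflength_eq_codimfix[OF assms(1)]) auto
  then show ?thesis by auto
qed

end
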